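(* Let $p$ be an odd prime, let $n\geq 1$ be an odd integer, $q=p^n$, and let $s$ be a nonnegative integer coprime to $n$ with $s<n/2$. Let $X$ be the complete set of mutually unbiased bases in $\mathbb{C}^{q}$ consisting of the standard basis of $\mathbb{C}^q$ together with all the vectors $$\vec v_{ab}=\frac{1}{\sqrt q}\left(\omega_p^{\mathrm{tr}\left(ax+bx^{p^{n-s}+1}+b^{p^s}x^{p^s+1}\right)}\right)_{x\in\mathbb{F}_q},\qquad a,b\in\mathbb{F}_q.$$ Let $N=\{\vec v_{ab}:a,b\in\mathbb{F}_q\}$ be the set of those vectors of $X$ which are of the form $\frac{1}{\sqrt q}\,\omega_p^{\vec x}$ with $\vec x\in\mathbb{F}_p^{p^n}$, and let $M=\{\vec x\in\mathbb{F}_p^{p^n}:\frac{1}{\sqrt q}\,\omega_p^{\vec x}\in N\}$. Then: 1. $N$ with the operation $\hat\odot$ (and scalar action $\star$) is an $\mathbb{F}_p$-module. 2. $M$ is a $(2n-1)$-dimensional subspace of $PG(p^n-1,p)$; that is, $M$ is an $\mathbb{F}_p$-linear subspace of $\mathbb{F}_p^{p^n}$ of vector space dimension $2n$.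
   Context: Here $\omega_p=e^{2\pi i/p}$ and $\mathrm{tr}:\mathbb{F}_q\to\mathbb{F}_p$ is the absolute trace. Coordinates of vectors in $\mathbb{C}^{q}$ and in $\mathbb{F}_p^{p^n}$ are indexed by $x\in\mathbb{F}_q$. For $\vec x=(x_j)\in\mathbb{F}_p^{p^n}$, $\omega_p^{\vec x}$ denotes the complex vector $(\omega_p^{x_j})_j$ (identifying $\mathbb{F}_p=\mathbb{Z}/p\mathbb{Z}$). Let $\odot$ be componentwise multiplication of complex vectors and define $\vec v\,\hat\odot\,\vec u=\dfrac{\vec v\odot\vec u}{|\vec v\odot\vec u|}$, where $|\cdot|$ is the Euclidean norm. The scalar action of $r\in\mathbb{F}_p$ on a vector $\frac{1}{\sqrt q}\omega_p^{\vec x}$ is $r\star\frac{1}{\sqrt q}\omega_p^{\vec x}=\frac{1}{\sqrt q}\omega_p^{r\vec x}$, i.e. it corresponds to scalar multiplication on exponent vectors. $PG(d-1,p)$ is the projective geometry of linear subspaces of $\mathbb{F}_p^d$; its points are the classes $\langle\vec x\rangle=\{\rho\vec x:\rho\in\mathbb{F}_p^*\}$ with $\vec x\ne\vec 0$, and a $k$-dimensional subspace of $PG(d-1,p)$ is a $(k+1)$-dimensional linear subspace of $\mathbb{F}_p^d$. Two orthonormal bases of $\mathbb{C}^d$ are mutually unbiased if $|\langle\phi|\psi\rangle|^2=1/d$ for all $\phi$ in the first and $\psi$ in the second; a set of $d+1$ pairwise mutually unbiased bases of $\mathbb{C}^d$ is called complete. *)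

theory Defs
  imports "HOL-Analysis.Analysis" "HOL-Algebra.Module" "Berlekamp_Zassenhaus.Finite_Field"
begin

text \<open>
  The prime field is \<^typ>\<open>'p mod_ring\<close> with \<open>'p :: prime_card\<close>, that is, the integers modulo
  the prime \<open>CARD('p)\<close>. The field with \<open>q\<close> elements is any type \<open>'a :: {field, finite}\<close> with
  \<open>CARD('a) = q\<close>; vectors with coordinates indexed by it have type \<open>_ ^ 'a\<close>.
\<close>

definition of_prime_field :: "'p::prime_card mod_ring \<Rightarrow> 'a::field" where
  "of_prime_field t = of_int (to_int_mod_ring t)"

text \<open>
  If \<open>'a\<close> has \<open>CARD('p) ^ n\<close> elements, the sum below is fixed by the Frobenius map, hence lies in
  the prime subfield, and \<^const>\<open>of_prime_field\<close> is injective; so the description is proper.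
\<close>

definition abs_trace :: "nat \<Rightarrow> 'a::{field,finite} \<Rightarrow> 'p::prime_card mod_ring" where
  "abs_trace n x = (THE t. of_prime_field t = (\<Sum>i<n. x ^ (CARD('p) ^ i)))"

definition omega_pow :: "'p::prime_card mod_ring \<Rightarrow> complex" where
  "omega_pow t = exp (2 * complex_of_real pi * \<i> / of_nat CARD('p)) powi to_int_mod_ring t"

definition phase_vec :: "('p::prime_card mod_ring) ^ 'a::finite \<Rightarrow> complex ^ 'a" where
  "phase_vec x = (\<chi> j. complex_of_real (1 / sqrt (real CARD('a))) * omega_pow (x $ j))"

definition exponent_vec ::
    "nat \<Rightarrow> nat \<Rightarrow> 'a::{field,finite} \<Rightarrow> 'a \<Rightarrow> ('p::prime_card mod_ring, 'a) vec" where
  "exponent_vec n s a b =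
     (\<chi> x. abs_trace n
        (a * x + b * x ^ (CARD('p) ^ (n - s) + 1) + b ^ (CARD('p) ^ s) * x ^ (CARD('p) ^ s + 1)))"

definition hat_mult :: "complex ^ 'a::finite \<Rightarrow> complex ^ 'a \<Rightarrow> complex ^ 'a" where
  "hat_mult v u = (let w = (\<chi> j. v $ j * u $ j) in w /\<^sub>R norm w)"

text \<open>
  The exponent vector of a phase vector is unique; the action is only meaningful on phase vectors.
\<close>

definition star_action :: "'p::prime_card mod_ring \<Rightarrow> complex ^ 'a::finite \<Rightarrow> complex ^ 'a" where
  "star_action r v = phase_vec (r *s (THE x :: ('p mod_ring) ^ 'a. v = phase_vec x))"

definition prime_field_ring :: "('p::prime_card mod_ring) ring" where
  "prime_field_ring = \<lparr>carrier = UNIV, mult = (*), one = 1, zero = 0, add = (+)\<rparr>"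

text \<open>
  Module records extend ring records; the module axioms do not mention the fields
  \<open>mult\<close> and \<open>one\<close> of the module record, which are left unspecified.
\<close>

definition phase_module ::
    "(complex ^ 'a::finite) set \<Rightarrow> ('p::prime_card mod_ring, complex ^ 'a) module" where
  "phase_module N =
     \<lparr>carrier = N, mult = undefined, one = undefined,
      zero = phase_vec (0 :: ('p mod_ring) ^ 'a), add = hat_mult, smult = star_action\<rparr>"

definition herm_inner :: "complex ^ 'a::finite \<Rightarrow> complex ^ 'a \<Rightarrow> complex" where
  "herm_inner u v = (\<Sum>j\<in>UNIV. cnj (u $ j) * v $ j)"

definition orthonormal_basis :: "(complex ^ 'a::finite) set \<Rightarrow> bool" where
  "orthonormal_basis B \<longleftrightarrow>
     (\<forall>u\<in>B. \<forall>v\<in>B. herm_inner u v = (if u = v then 1 else 0)) \<and> vec.span B = UNIV"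

definition mutually_unbiased :: "(complex ^ 'a::finite) set \<Rightarrow> (complex ^ 'a) set \<Rightarrow> bool" where
  "mutually_unbiased B C \<longleftrightarrow>
     (\<forall>u\<in>B. \<forall>v\<in>C. (cmod (herm_inner u v))\<^sup>2 = 1 / real CARD('a))"

definition complete_MUBs :: "(complex ^ 'a::finite) set set \<Rightarrow> bool" where
  "complete_MUBs X \<longleftrightarrow>
     card X = CARD('a) + 1 \<and> (\<forall>B\<in>X. orthonormal_basis B) \<and>
     (\<forall>B\<in>X. \<forall>C\<in>X. B \<noteq> C \<longrightarrow> mutually_unbiased B C)"

definition standard_basis :: "(complex ^ 'a::finite) set" where
  "standard_basis = range (\<lambda>i. axis i 1)"

text \<open>A \<open>k\<close>-dimensional subspace of the projective geometry of \<open>F ^ 'a\<close>.\<close>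

definition PG_subspace :: "nat \<Rightarrow> ('f::field ^ 'a::finite) set \<Rightarrow> bool" where
  "PG_subspace k U \<longleftrightarrow> vec.subspace U \<and> vec.dim U = k + 1"

end

theory Submission
  imports Defs
begin

text \<open>
  Raising \<open>b x^(p^(n-s)+1)\<close> to the power \<open>p^s\<close> does not change its trace, so the exponent of \<open>v a b\<close>
  at \<open>x\<close> is \<open>tr (a x + 2 b^(p^s) x^(p^s+1))\<close>, which is additive in \<open>(a, b)\<close>. Inner products of the
  vectors are therefore character sums of the same shape. For \<open>b = 0\<close> they are orthogonality sums; for
  \<open>b \<noteq> 0\<close> they have squared modulus \<open>q\<close>, because \<open>y \<mapsto> y^(p^s) z + z^(p^s) y\<close> is bijective for every
  \<open>z \<noteq> 0\<close> when \<open>n\<close> and \<open>p\<close> are odd. This gives the unbiased bases, and with them the injectivity of the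
  linear map sending \<open>(a, b)\<close> to its exponent vector, so that its image has \<open>p^(2n)\<close> elements.
\<close>

section \<open>The trace of a finite field\<close>

text \<open>Multiplication by a nonzero \<open>x\<close> permutes the nonzero elements. Comparing
  the product of all of them before and after, and cancelling it, shows that \<open>x\<close> to the
  power \<open>CARD('a) - 1\<close> is 1.\<close>

lemma finite_field_power_CARD:
  fixes x :: "'a::{field,finite}"
  shows "x ^ CARD('a) = x"
proof (cases "x = 0")
  case False
  let ?U = "UNIV - {0 :: 'a}"
  have "bij_betw ((*) x) ?U ?U"
    by (rule bij_betwI[of _ _ _ "\<lambda>y. y / x"]) (use False in auto)
  then have "prod ((*) x) ?U = \<Prod>?U"
    by (rule prod.reindex_bij_betw)
  moreover have "prod ((*) x) ?U = x ^ card ?U * \<Prod>?U"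
    by (simp add: prod.distrib)
  moreover have "\<Prod>?U \<noteq> 0" by simp
  ultimately have "x ^ card ?U = 1" by simp
  moreover have "CARD('a) = Suc (card ?U)"
    by (rule card.remove) simp_all
  ultimately show ?thesis by (simp only: power_Suc mult_1_right)
qed (simp add: card_gt_0_iff)

context
  fixes n :: nat
  assumes CARD_eq: "CARD('a::{field,finite}) = CARD('p::prime_card) ^ n"
begin

lemma exponent_pos: "n > 0"
proof (rule ccontr)
  assume "\<not> n > 0"
  then have "CARD('a) = 1" using CARD_eq by simp
  then obtain z :: 'a where "UNIV = {z}" by (meson card_1_singletonE)
  then show False by (metis UNIV_I singletonD zero_neq_one)
qed

text \<open>The characteristic is a prime that divides the order of the field, which is a power of
  the prime \<open>CARD('p)\<close>.\<close>

lemma CHAR_eq: "CHAR('a) = CARD('p)"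
proof -
  have "prime CHAR('a)"
    by (rule prime_CHAR_semidom) (simp add: finite_imp_CHAR_pos)
  moreover have "CHAR('a) dvd CARD('p) ^ n"
    using CHAR_dvd_CARD[where 'a = 'a] CARD_eq by simp
  ultimately have "CHAR('a) dvd CARD('p)"
    using prime_dvd_power by blast
  with \<open>prime CHAR('a)\<close> show ?thesis
    using prime_card[where 'a = 'p] primes_dvd_imp_eq by blast
qed

lemma prime_CHAR: "prime CHAR('a)"
  by (simp add: CHAR_eq prime_card)

lemma frobenius_add: "(x + y :: 'a) ^ (CARD('p) ^ k) = x ^ (CARD('p) ^ k) + y ^ (CARD('p) ^ k)"
  by (rule freshmans_dream'[OF prime_CHAR]) (simp add: CHAR_eq)

lemma frobenius_period: "(x :: 'a) ^ (CARD('p) ^ (n * k)) = x"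
proof (induction k)
  case (Suc k)
  have "x ^ (CARD('p) ^ (n * Suc k)) = (x ^ (CARD('p) ^ (n * k))) ^ CARD('a)"
    by (simp add: CARD_eq power_add mult.commute flip: power_mult)
  with Suc show ?case by (simp only: finite_field_power_CARD)
qed simp

text \<open>Since \<open>CARD('p)\<close> is 0 in \<open>'a\<close>, reduction of representatives is
  invisible there. This is what makes \<open>of_prime_field\<close> respect sums and
  products.\<close>

lemma of_int_mod_CARD: "(of_int (m mod int CARD('p)) :: 'a) = of_int m"
proof -
  have "(of_nat CARD('p) :: 'a) = 0" by (metis CHAR_eq of_nat_CHAR)
  moreover have "(of_int m :: 'a) = of_int (m mod int CARD('p) + int CARD('p) * (m div int CARD('p)))"
    by simp
  ultimately show ?thesis
    by (simp only: of_int_add of_int_mult of_int_of_nat_eq) simp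
qed

lemma of_prime_field_add:
  "(of_prime_field (s + t :: 'p mod_ring) :: 'a) = of_prime_field s + of_prime_field t"
proof -
  have "to_int_mod_ring (s + t) = (to_int_mod_ring s + to_int_mod_ring t) mod int CARD('p)"
    by transfer simp
  then show ?thesis by (simp only: of_prime_field_def of_int_mod_CARD of_int_add)
qed

lemma of_prime_field_mult:
  "(of_prime_field (s * t :: 'p mod_ring) :: 'a) = of_prime_field s * of_prime_field t"
proof -
  have "to_int_mod_ring (s * t) = (to_int_mod_ring s * to_int_mod_ring t) mod int CARD('p)"
    by transfer simp
  then show ?thesis by (simp only: of_prime_field_def of_int_mod_CARD of_int_mult)
qed

lemma of_prime_field_power:
  "(of_prime_field (t ^ k :: 'p mod_ring) :: 'a) = of_prime_field t ^ k"
  by (induction k) (simp_all add: of_prime_field_mult, simp add: of_prime_field_def)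

lemma of_prime_field_frobenius:
  "(of_prime_field (t :: 'p mod_ring) :: 'a) ^ (CARD('p) ^ k) = of_prime_field t"
proof -
  have "t ^ (CARD('p) ^ k) = t"
    by (rule finite_field_power_card_power_eq_same) simp
  then show ?thesis by (metis of_prime_field_power)
qed

text \<open>A nonzero element of the kernel would be invertible, so 1 would lie in the kernel
  too.\<close>

lemma of_prime_field_inj: "inj (of_prime_field :: 'p mod_ring \<Rightarrow> 'a)"
proof (rule injI)
  fix s t :: "'p mod_ring"
  assume eq: "(of_prime_field s :: 'a) = of_prime_field t"
  show "s = t"
  proof (rule ccontr)
    assume "s \<noteq> t"
    then have "(s - t) * inverse (s - t) = 1" by simp
    moreover have "(of_prime_field (s - t) :: 'a) = 0"
      using of_prime_field_add[of "s - t" t] eq by simp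
    ultimately have "(of_prime_field (1 :: 'p mod_ring) :: 'a) = 0"
      by (metis of_prime_field_mult mult_zero_left)
    then show False by (simp add: of_prime_field_def)
  qed
qed

text \<open>The image consists of p distinct roots of X^p - X, and this polynomial has at most p
  roots.\<close>

lemma range_of_prime_field: "range (of_prime_field :: 'p mod_ring \<Rightarrow> 'a) = {x. x ^ CARD('p) = x}"
proof (rule card_seteq)
  let ?f = "Polynomial.monom 1 CARD('p) - Polynomial.monom 1 1 :: 'a poly"
  have p: "CARD('p) > 1" using nontriv[where 'a = 'p] .
  then have "Polynomial.coeff ?f CARD('p) = 1" by simp
  then have "?f \<noteq> 0" by (metis coeff_0 zero_neq_one)
  then have "card {x. poly ?f x = 0} \<le> degree ?f" by (rule card_poly_roots_bound)
  moreover have "degree ?f \<le> CARD('p)"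
    using p by (intro degree_diff_le order.trans[OF degree_monom_le]) auto
  ultimately have "card {x :: 'a. x ^ CARD('p) = x} \<le> CARD('p)"
    by (simp add: poly_monom)
  then show "card {x :: 'a. x ^ CARD('p) = x} \<le> card (range (of_prime_field :: 'p mod_ring \<Rightarrow> 'a))"
    by (simp add: card_image[OF of_prime_field_inj])
  show "range (of_prime_field :: 'p mod_ring \<Rightarrow> 'a) \<subseteq> {x :: 'a. x ^ CARD('p) = x}"
    using of_prime_field_frobenius[of _ 1] by auto
qed simp

text \<open>The p-th power shifts the index of each term by one, and the term x^(p^n) pushed out at
  the top is x again, the term lost at the bottom.\<close>

lemma trace_sum_frobenius:
  "(\<Sum>i<n. (x ^ CARD('p)) ^ (CARD('p) ^ i)) = (\<Sum>i<n. (x :: 'a) ^ (CARD('p) ^ i))"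
proof -
  have "(\<Sum>i<n. x ^ (CARD('p) ^ Suc i)) + x = (\<Sum>i<n. x ^ (CARD('p) ^ i)) + x ^ (CARD('p) ^ n)"
    using sum.lessThan_Suc_shift[of "\<lambda>i. x ^ (CARD('p) ^ i)" n]
    by (simp only: sum.lessThan_Suc power_0 power_one_right add.commute)
  moreover have "x ^ (CARD('p) ^ n) = x" using frobenius_period[of x 1] by simp
  ultimately show ?thesis by (simp flip: power_mult)
qed

text \<open>The sum is fixed by the p-th power map, so it lies in the image of
  \<open>of_prime_field\<close>. With injectivity, the description in \<open>abs_trace\<close> has
  exactly one solution.\<close>

lemma of_prime_field_abs_trace:
  "of_prime_field (abs_trace n x :: 'p mod_ring) = (\<Sum>i<n. (x :: 'a) ^ (CARD('p) ^ i))"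
proof -
  let ?T = "\<Sum>i<n. x ^ (CARD('p) ^ i)"
  have "?T ^ CARD('p) = (\<Sum>i<n. (x ^ (CARD('p) ^ i)) ^ CARD('p))"
    by (rule freshmans_dream_sum[OF prime_CHAR]) (simp add: CHAR_eq)
  also have "\<dots> = (\<Sum>i<n. (x ^ CARD('p)) ^ (CARD('p) ^ i))"
    by (simp add: mult.commute flip: power_mult)
  also have "\<dots> = ?T" by (rule trace_sum_frobenius)
  finally have "?T \<in> range (of_prime_field :: 'p mod_ring \<Rightarrow> 'a)"
    by (simp add: range_of_prime_field)
  then obtain t :: "'p mod_ring" where t: "of_prime_field t = ?T" by (metis rangeE)
  show ?thesis
    unfolding abs_trace_def
    by (rule theI[where P = "\<lambda>t. of_prime_field t = ?T", OF t])
      (metis t of_prime_field_inj injD)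
qed

lemma abs_trace_eqI:
  "of_prime_field t = (\<Sum>i<n. (x :: 'a) ^ (CARD('p) ^ i)) \<Longrightarrow> abs_trace n x = (t :: 'p mod_ring)"
  by (metis of_prime_field_abs_trace of_prime_field_inj injD)

lemma abs_trace_add: "(abs_trace n (x + y :: 'a) :: 'p mod_ring) = abs_trace n x + abs_trace n y"
  by (rule abs_trace_eqI)
    (simp add: of_prime_field_add of_prime_field_abs_trace frobenius_add sum.distrib)

lemma abs_trace_scale:
  "(abs_trace n (of_prime_field c * x :: 'a) :: 'p mod_ring) = c * abs_trace n x"
  by (rule abs_trace_eqI)
    (simp add: of_prime_field_mult of_prime_field_abs_trace power_mult_distrib
      of_prime_field_frobenius sum_distrib_left)

lemma abs_trace_frobenius: "(abs_trace n (x ^ (CARD('p) ^ k) :: 'a) :: 'p mod_ring) = abs_trace n x"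
proof (induction k)
  case (Suc k)
  have "(abs_trace n ((x ^ (CARD('p) ^ k)) ^ CARD('p) :: 'a) :: 'p mod_ring)
      = abs_trace n (x ^ (CARD('p) ^ k))"
    by (rule abs_trace_eqI) (simp add: of_prime_field_abs_trace trace_sum_frobenius)
  with Suc show ?case by (simp add: mult.commute flip: power_mult)
qed simp

text \<open>Otherwise the trace polynomial, of degree at most p^(n-1), would have all p^n field
  elements as roots.\<close>

lemma abs_trace_nonzero: "\<exists>x :: 'a. (abs_trace n x :: 'p mod_ring) \<noteq> 0"
proof (rule ccontr)
  assume "\<not> ?thesis"
  then have zero: "(\<Sum>i<n. (x :: 'a) ^ (CARD('p) ^ i)) = 0" for x
    by (simp add: of_prime_field_def flip: of_prime_field_abs_trace)
  let ?f = "\<Sum>i<n. Polynomial.monom 1 (CARD('p) ^ i) :: 'a poly"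
  have p: "CARD('p) > 1" using nontriv[where 'a = 'p] .
  \<comment> \<open>The exponents p^i are pairwise distinct, so only the last monomial contributes
    to this coefficient.\<close>
  have "Polynomial.coeff ?f (CARD('p) ^ (n - 1)) = (\<Sum>i<n. if i = n - 1 then 1 else 0)"
    unfolding Polynomial.coeff_sum Polynomial.coeff_monom
    by (intro sum.cong refl) (use p in \<open>auto simp: power_inject_exp\<close>)
  also have "\<dots> = 1" using exponent_pos by simp
  finally have "?f \<noteq> 0" by (metis coeff_0 zero_neq_one)
  then have "card {x. poly ?f x = 0} \<le> degree ?f" by (rule card_poly_roots_bound)
  moreover have "poly ?f x = 0" for x by (simp add: poly_sum poly_monom zero)
  ultimately have "CARD('a) \<le> degree ?f" by simp
  also have "degree ?f \<le> CARD('p) ^ (n - 1)"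
    by (intro degree_sum_le order.trans[OF degree_monom_le] power_increasing) (use p in auto)
  also have "\<dots> < CARD('p) ^ n" using p exponent_pos by (intro power_strict_increasing) auto
  finally show False using CARD_eq by simp
qed

end

section \<open>Characters and phase vectors\<close>

lemma omega_pow_eq_cis: "omega_pow (t :: 'p::prime_card mod_ring) =
    cis (2 * pi * of_int (to_int_mod_ring t) / CARD('p))"
proof -
  have "omega_pow t = cis (2 * pi / CARD('p)) powi to_int_mod_ring t"
    by (simp add: omega_pow_def cis_conv_exp mult_ac)
  then show ?thesis by (simp add: cis_power_int mult_ac)
qed

text \<open>Dropping a multiple of p changes the angle by a multiple of 2 pi.\<close>

lemma cis_mod_CARD: "cis (2 * pi * of_int (k mod int CARD('p::prime_card)) / CARD('p))
    = cis (2 * pi * of_int k / CARD('p))"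
proof -
  have "(of_int k :: real) = of_int (int CARD('p) * (k div int CARD('p)) + k mod int CARD('p))"
    by simp
  then have "2 * pi * of_int k / CARD('p)
      = 2 * pi * of_int (k mod int CARD('p)) / CARD('p) + 2 * pi * of_int (k div int CARD('p))"
    by (simp only: of_int_add of_int_mult of_int_of_nat_eq) (simp add: field_simps)
  then show ?thesis by (simp flip: cis_mult)
qed

lemma omega_pow_add: "omega_pow (s + t :: 'p::prime_card mod_ring) = omega_pow s * omega_pow t"
proof -
  have "to_int_mod_ring (s + t) = (to_int_mod_ring s + to_int_mod_ring t) mod int CARD('p)"
    by transfer simp
  then have "omega_pow (s + t)
      = cis (2 * pi * of_int (to_int_mod_ring s + to_int_mod_ring t) / CARD('p))"
    by (simp only: omega_pow_eq_cis cis_mod_CARD)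
  then show ?thesis by (simp add: omega_pow_eq_cis cis_mult field_simps)
qed

lemma omega_pow_0 [simp]: "omega_pow 0 = 1"
  by (simp add: omega_pow_def)

lemma norm_omega_pow [simp]: "norm (omega_pow t) = 1"
  by (simp add: omega_pow_eq_cis)

lemma omega_pow_nonzero [simp]: "omega_pow t \<noteq> 0"
  by (metis norm_omega_pow norm_zero zero_neq_one)

text \<open>Both sides are inverse to \<open>omega_pow t\<close>, which has modulus 1.\<close>

lemma omega_pow_minus: "omega_pow (- t) = cnj (omega_pow t)"
proof -
  have "omega_pow (- t) * omega_pow t = 1" by (simp flip: omega_pow_add)
  moreover have "cnj (omega_pow t) * omega_pow t = 1"
    using complex_norm_square[of "omega_pow t"] by (simp add: mult.commute)
  ultimately show ?thesis by (metis mult_right_cancel omega_pow_nonzero)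
qed

lemma omega_pow_eq_1_iff: "omega_pow (t :: 'p::prime_card mod_ring) = 1 \<longleftrightarrow> t = 0"
proof
  assume eq: "omega_pow t = 1"
  let ?k = "to_int_mod_ring t"
  have "exp (\<i> * complex_of_real (2 * pi * of_int ?k / CARD('p))) = 1"
    using eq by (simp add: omega_pow_eq_cis cis_conv_exp)
  then obtain m :: int where "2 * pi * of_int ?k / CARD('p) = of_int (2 * m) * pi"
    unfolding exp_eq_1 by auto
  then have "(of_int ?k :: real) = of_int (m * int CARD('p))"
    by (simp add: field_simps)
  then have "?k = m * int CARD('p)" by (simp only: of_int_eq_iff)
  moreover have "0 \<le> ?k" "?k < int CARD('p)"
    using range_to_int_mod_ring[where 'a = 'p] by auto
  ultimately have "?k = 0"
    by (metis mod_mult_self2_is_0 mod_pos_pos_trivial)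
  then show "t = 0" by simp
qed simp

lemma omega_pow_eq_iff: "omega_pow s = omega_pow t \<longleftrightarrow> s = t"
proof
  assume "omega_pow s = omega_pow t"
  then have "omega_pow (s - t) = omega_pow (t - t)"
    by (simp only: diff_conv_add_uminus omega_pow_add)
  then show "s = t" by (simp add: omega_pow_eq_1_iff)
qed simp

text \<open>Translating by a point where \<open>f\<close> does not vanish multiplies the sum by a root of unity different from 1.\<close>

lemma character_sum_zero:
  fixes f :: "'a::{ab_group_add,finite} \<Rightarrow> 'p::prime_card mod_ring"
  assumes add: "\<And>x y. f (x + y) = f x + f y" and "f z \<noteq> 0"
  shows "(\<Sum>x\<in>UNIV. omega_pow (f x)) = 0"
proof -
  have "(\<Sum>x\<in>UNIV. omega_pow (f x)) = (\<Sum>x\<in>UNIV. omega_pow (f (z + x)))"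
    by (rule sum.reindex_bij_witness[of _ "\<lambda>x. z + x" "\<lambda>x. x - z"]) auto
  also have "\<dots> = omega_pow (f z) * (\<Sum>x\<in>UNIV. omega_pow (f x))"
    by (simp add: add omega_pow_add sum_distrib_left)
  finally have "(1 - omega_pow (f z)) * (\<Sum>x\<in>UNIV. omega_pow (f x)) = 0"
    by (simp add: algebra_simps)
  with \<open>f z \<noteq> 0\<close> show ?thesis by (simp add: omega_pow_eq_1_iff)
qed

section \<open>Phase vectors and their module structure\<close>

lemma phase_vec_nth: "phase_vec x $ j = of_real (1 / sqrt (real CARD('a))) * omega_pow (x $ j)"
  for x :: "('p::prime_card mod_ring) ^ 'a::finite"
  by (simp add: phase_vec_def)

lemma phase_vec_eq_iff: "phase_vec x = phase_vec y \<longleftrightarrow> x = y"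
  for x y :: "('p::prime_card mod_ring) ^ 'a::finite"
  by (simp add: vec_eq_iff phase_vec_nth omega_pow_eq_iff)

lemma norm_phase_vec: "norm (phase_vec (x :: ('p::prime_card mod_ring) ^ 'a::finite)) = 1"
  by (simp add: norm_vec_def L2_set_def phase_vec_nth norm_mult norm_divide power_divide)

lemma hat_mult_phase_vec: "hat_mult (phase_vec x) (phase_vec y) = phase_vec (x + y)"
  for x y :: "('p::prime_card mod_ring) ^ 'a::finite"
proof -
  let ?r = "1 / sqrt (real CARD('a))"
  \<comment> \<open>The product carries the normalising factor twice; the surplus positive factor
    \<open>?r\<close> is removed by the division by the norm.\<close>
  have eq: "(\<chi> j. phase_vec x $ j * phase_vec y $ j) = ?r *\<^sub>R phase_vec (x + y)"
    by (simp add: vec_eq_iff phase_vec_nth omega_pow_add scaleR_conv_of_real[where 'a = complex])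
  have "?r > 0" by simp
  then show ?thesis
    unfolding hat_mult_def Let_def eq by (simp add: norm_phase_vec)
qed

lemma star_action_phase_vec: "star_action r (phase_vec x) = phase_vec (r *s x)"
  for x :: "('p::prime_card mod_ring) ^ 'a::finite"
  by (simp add: star_action_def phase_vec_eq_iff)

lemma herm_inner_phase_vec:
  fixes x y :: "('p::prime_card mod_ring) ^ 'a::finite"
  shows "herm_inner (phase_vec x) (phase_vec y)
    = (\<Sum>j\<in>UNIV. omega_pow ((y - x) $ j)) / of_nat CARD('a)"
proof -
  have "of_real (sqrt (real CARD('a))) * of_real (sqrt (real CARD('a))) = (of_nat CARD('a) :: complex)"
    by (simp flip: of_real_mult)
  then show ?thesis
    by (simp add: herm_inner_def phase_vec_nth sum_divide_distrib diff_conv_add_uminus omega_pow_add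
        omega_pow_minus mult_ac del: add_uminus_conv_diff)
qed

text \<open>\<open>phase_vec\<close> carries addition and scaling of exponent vectors to
  \<open>hat_mult\<close> and \<open>star_action\<close>, so the module axioms are inherited from
  the subspace \<open>M\<close>.\<close>

lemma module_phase_module:
  fixes M :: "(('p::prime_card mod_ring) ^ 'a::finite) set"
  assumes "vec.subspace M"
  shows "Module.module (prime_field_ring :: 'p mod_ring ring)
    (phase_module (phase_vec ` M) :: ('p mod_ring, complex ^ 'a) module)"
proof (rule moduleI)
  note sub = vec.subspace_0[OF assms] vec.subspace_add[OF assms] vec.subspace_scale[OF assms]
  show "cring (prime_field_ring :: 'p mod_ring ring)"
  proof (rule cringI)
    show "abelian_group (prime_field_ring :: 'p mod_ring ring)"
      by (rule abelian_groupI) (auto simp: prime_field_ring_def add_ac intro: exI[of _ "- _"] left_minus)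
    show "comm_monoid (prime_field_ring :: 'p mod_ring ring)"
      by (rule comm_monoidI) (auto simp: prime_field_ring_def mult_ac)
  qed (auto simp: prime_field_ring_def algebra_simps)
  show "abelian_group (phase_module (phase_vec ` M) :: ('p mod_ring, complex ^ 'a) module)"
  proof (rule abelian_groupI)
    fix u assume "u \<in> carrier (phase_module (phase_vec ` M) :: ('p mod_ring, complex ^ 'a) module)"
    then obtain x where x: "x \<in> M" "u = phase_vec x" by (auto simp: phase_module_def)
    then have "phase_vec (- x) \<in> phase_vec ` M"
      "hat_mult (phase_vec (- x)) u = phase_vec (0 :: 'p mod_ring ^ 'a)"
      using vec.subspace_neg[OF assms] by (auto simp: hat_mult_phase_vec)
    then show "\<exists>y\<in>carrier (phase_module (phase_vec ` M) :: ('p mod_ring, complex ^ 'a) module).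
        y \<oplus>\<^bsub>phase_module (phase_vec ` M) :: ('p mod_ring, complex ^ 'a) module\<^esub> u
        = \<zero>\<^bsub>phase_module (phase_vec ` M) :: ('p mod_ring, complex ^ 'a) module\<^esub>"
      by (auto simp: phase_module_def)
  qed (auto simp: phase_module_def hat_mult_phase_vec sub add_ac)
qed (auto simp: phase_module_def prime_field_ring_def hat_mult_phase_vec star_action_phase_vec
      vec.subspace_add[OF assms] vec.subspace_scale[OF assms]
      vec.scale_left_distrib vec.scale_right_distrib)

section \<open>Subspaces and orthonormal bases\<close>

text \<open>Coordinates with respect to a basis \<open>B\<close> identify \<open>M\<close> with the
  functions from \<open>B\<close> to the scalars. Taking these functions extensional makes the
  coordinates unique.\<close>

lemma card_subspace:
  fixes M :: "('f::{field,finite} ^ 'a::finite) set"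
  assumes "vec.subspace M"
  shows "card M = CARD('f) ^ vec.dim M"
proof -
  obtain B where B: "B \<subseteq> M" "vec.independent B" "M \<subseteq> vec.span B" "card B = vec.dim M"
    using vec.basis_exists by blast
  have fin: "finite B" by simp
  let ?c = "\<lambda>u. \<Sum>b\<in>B. u b *s b"
  have M: "M = vec.span B"
    using B assms by (metis vec.span_minimal subset_antisym)
  have "bij_betw ?c (B \<rightarrow>\<^sub>E UNIV) M"
    unfolding bij_betw_def
  proof
    show "inj_on ?c (B \<rightarrow>\<^sub>E UNIV)"
    proof (rule inj_onI)
      fix u w
      assume u: "u \<in> B \<rightarrow>\<^sub>E UNIV" and w: "w \<in> B \<rightarrow>\<^sub>E UNIV" and eq: "?c u = ?c w"
      have "(\<Sum>b\<in>B. (u b - w b) *s b) = 0"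
        using eq by (simp add: vec.scale_left_diff_distrib sum_subtractf)
      then have "u b - w b = 0" if "b \<in> B" for b
        using vec.independentD[OF B(2) fin subset_refl _ that, of "\<lambda>b. u b - w b"] by blast
      then show "u = w" using PiE_ext[OF u w] by simp
    qed
    show "?c ` (B \<rightarrow>\<^sub>E UNIV) = M"
    proof
      show "M \<subseteq> ?c ` (B \<rightarrow>\<^sub>E UNIV)"
      proof
        fix x assume "x \<in> M"
        then obtain u where "x = ?c u" by (auto simp: M vec.span_finite)
        then have "x = ?c (restrict u B)" by simp
        then show "x \<in> ?c ` (B \<rightarrow>\<^sub>E UNIV)" by (rule image_eqI[where f = ?c])
            (auto simp: restrict_def)
      qed
    qed (auto simp: M vec.span_finite[OF fin])
  qed
  then have "card M = card (B \<rightarrow>\<^sub>E (UNIV :: 'f set))" by (simp add: bij_betw_same_card)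
  also have "\<dots> = CARD('f) ^ card B" by (simp add: card_PiE)
  finally show ?thesis by (simp add: B)
qed

lemma herm_inner_sum_right: "herm_inner u (\<Sum>b\<in>B. c b *s b) = (\<Sum>b\<in>B. c b * herm_inner u b)"
  unfolding herm_inner_def
  by (simp add: sum_distrib_left sum_distrib_right mult_ac) (subst sum.swap, simp add: mult_ac)

text \<open>Orthonormal vectors are independent, and there are as many of them as the dimension, so
  they span.\<close>

lemma orthonormal_basis_range:
  fixes f :: "'a::finite \<Rightarrow> complex ^ 'a"
  assumes f: "\<And>i j. herm_inner (f i) (f j) = (if i = j then 1 else 0)"
  shows "orthonormal_basis (range f)"
proof -
  have inj: "inj f" by (rule injI) (metis f zero_neq_one)
  have orth: "herm_inner u v = (if u = v then 1 else 0)" if "u \<in> range f" "v \<in> range f" for u v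
    using that by (auto simp: f inj_eq[OF inj])
  have "vec.independent (range f)"
  proof (rule vec.independent_if_scalars_zero)
    fix c u assume 0: "(\<Sum>v\<in>range f. c v *s v) = 0" and u: "u \<in> range f"
    \<comment> \<open>The inner product with \<open>u\<close> isolates the coefficient of
      \<open>u\<close>.\<close>
    have "herm_inner u (\<Sum>v\<in>range f. c v *s v) = (\<Sum>v\<in>range f. if v = u then c v else 0)"
      unfolding herm_inner_sum_right by (intro sum.cong) (use u in \<open>auto simp: orth\<close>)
    also have "\<dots> = c u" by (subst sum.delta) (use u in auto)
    finally show "c u = 0" unfolding 0 by (simp add: herm_inner_def)
  qed simp
  moreover have "vec.dim (UNIV :: (complex ^ 'a) set) \<le> card (range f)"
    by (simp add: card_image[OF inj] card_cart_basis)
  ultimately have "UNIV \<subseteq> vec.span (range f)"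
    by (intro vec.card_ge_dim_independent) auto
  with orth show ?thesis by (auto simp: orthonormal_basis_def)
qed

lemma herm_inner_axis_left: "herm_inner (axis i 1) v = v $ i"
  by (simp add: herm_inner_def axis_def if_distrib if_distribR cong: if_cong)

lemma herm_inner_axis_right: "herm_inner v (axis i 1) = cnj (v $ i)"
  by (simp add: herm_inner_def axis_def if_distrib if_distribR cong: if_cong)

lemma orthonormal_standard_basis: "orthonormal_basis (standard_basis :: (complex ^ 'a::finite) set)"
  unfolding standard_basis_def
  by (rule orthonormal_basis_range) (simp add: herm_inner_axis_left, simp add: axis_def)

lemma cmod_herm_inner_axis_phase_vec:
  fixes x :: "('p::prime_card mod_ring) ^ 'a::finite"
  shows "(cmod (herm_inner (axis i 1) (phase_vec x)))\<^sup>2 = 1 / real CARD('a)"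
    and "(cmod (herm_inner (phase_vec x) (axis i 1)))\<^sup>2 = 1 / real CARD('a)"
  by (simp_all add: herm_inner_axis_left herm_inner_axis_right phase_vec_nth norm_mult norm_divide
      power_divide)

text \<open>A common vector would have inner product 1 with itself, but also one of squared modulus
  \<open>1 / CARD('a)\<close>.\<close>

lemma mutually_unbiased_disjoint:
  fixes B C :: "(complex ^ 'a::finite) set"
  assumes "mutually_unbiased B C" "orthonormal_basis B" "CARD('a) \<noteq> 1"
  shows "B \<inter> C = {}"
proof (rule ccontr)
  assume "B \<inter> C \<noteq> {}"
  then obtain u where "u \<in> B" "u \<in> C" by blast
  then have "herm_inner u u = 1"
    using assms(2) unfolding orthonormal_basis_def by simp
  moreover have "(cmod (herm_inner u u))\<^sup>2 = 1 / real CARD('a)"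
    using assms(1) \<open>u \<in> B\<close> \<open>u \<in> C\<close> unfolding mutually_unbiased_def by blast
  ultimately show False using assms(3) by simp
qed

section \<open>Quadratic character sums and the bases\<close>

text \<open>The squared modulus is a double sum over \<open>f x - f y\<close>. After the
  substitution x = y + z, each nonzero shift \<open>z\<close> contributes 0 by assumption, and z = 0
  contributes one for each \<open>y\<close>.\<close>

lemma character_sum_flat:
  fixes f :: "'a::{ab_group_add,finite} \<Rightarrow> 'p::prime_card mod_ring"
  assumes "\<And>z. z \<noteq> 0 \<Longrightarrow> (\<Sum>y\<in>UNIV. omega_pow (f (y + z) - f y)) = 0"
  shows "(cmod (\<Sum>x\<in>UNIV. omega_pow (f x)))\<^sup>2 = real CARD('a)"
proof -
  let ?S = "\<Sum>x\<in>UNIV. omega_pow (f x)"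
  have "complex_of_real ((cmod ?S)\<^sup>2) = ?S * cnj ?S" by (rule complex_norm_square)
  also have "\<dots> = (\<Sum>y\<in>UNIV. \<Sum>x\<in>UNIV. omega_pow (f x - f y))"
    by (simp add: cnj_sum sum_product diff_conv_add_uminus omega_pow_add omega_pow_minus
        del: add_uminus_conv_diff) (rule sum.swap)
  also have "\<dots> = (\<Sum>y\<in>UNIV. \<Sum>z\<in>UNIV. omega_pow (f (y + z) - f y))"
  proof (rule sum.cong)
    show "(\<Sum>x\<in>UNIV. omega_pow (f x - f y)) = (\<Sum>z\<in>UNIV. omega_pow (f (y + z) - f y))" for y
      by (rule sum.reindex_bij_witness[of _ "\<lambda>z. y + z" "\<lambda>x. x - y"]) auto
  qed simp
  also have "\<dots> = (\<Sum>z\<in>UNIV. \<Sum>y\<in>UNIV. omega_pow (f (y + z) - f y))"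
    by (rule sum.swap)
  also have "\<dots> = (\<Sum>z\<in>UNIV. if z = (0 :: 'a) then of_nat CARD('a) else 0)"
    by (intro sum.cong refl) (simp add: assms)
  also have "\<dots> = complex_of_real (real CARD('a))" by simp
  finally show ?thesis by (simp only: of_real_eq_iff)
qed

context
  fixes n s :: nat and tr :: "'a::{field,finite} \<Rightarrow> 'p::prime_card mod_ring"
    and E :: "'a \<Rightarrow> 'a \<Rightarrow> ('p mod_ring, 'a) vec"
    and phase_basis :: "'a \<Rightarrow> (complex, 'a) vec set"
    and exponent_space :: "('p mod_ring, 'a) vec set"
  defines "tr \<equiv> abs_trace n" and "E \<equiv> exponent_vec n s"
    and "phase_basis \<equiv> \<lambda>b. range (\<lambda>a. phase_vec (E a b))"
    and "exponent_space \<equiv> range (\<lambda>(a, b). E a b)"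
  assumes CARD_eq: "CARD('a) = CARD('p) ^ n"
    and odd_p: "odd CARD('p)" and odd_n: "odd n" and s_le_n: "s \<le> n"
begin

section \<open>Consequences of odd characteristic and odd degree\<close>

lemmas tr_add = abs_trace_add[OF CARD_eq, folded tr_def]
lemmas tr_scale = abs_trace_scale[OF CARD_eq, folded tr_def]
lemmas tr_frobenius = abs_trace_frobenius[OF CARD_eq, folded tr_def]
lemmas tr_nonzero = abs_trace_nonzero[OF CARD_eq, folded tr_def]

lemma tr_diff: "tr (x - y) = tr x - tr y"
  using tr_add[of "x - y" y] by simp

lemma tr_0 [simp]: "tr 0 = 0"
  using tr_diff[of 0 0] by simp

lemma two_nonzero: "(2 :: 'a) \<noteq> 0"
proof
  assume "(2 :: 'a) = 0"
  then have "CHAR('a) dvd 2" using of_nat_eq_0_iff_char_dvd[of 2, where 'a = 'a] by simp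
  then have "CARD('p) \<le> 2" using CHAR_eq[OF CARD_eq] dvd_imp_le by simp
  moreover have "CARD('p) > 1" using nontriv[where 'a = 'p] .
  ultimately show False using odd_p by (cases "CARD('p) = 2") auto
qed

lemma CARD_ne_1: "CARD('a) \<noteq> 1"
  using exponent_pos[OF CARD_eq] nontriv[where 'a = 'p] by (simp add: CARD_eq)

text \<open>Applying this Frobenius power \<open>n\<close> times is the identity; as \<open>n\<close> is odd, \<open>w = - w\<close>.\<close>

lemma frobenius_neg_fixed_zero:
  assumes w: "(w :: 'a) ^ (CARD('p) ^ s) = - w"
  shows "w = 0"
proof -
  have odd_P: "odd (CARD('p) ^ s)" using odd_p by simp
  have "w ^ ((CARD('p) ^ s) ^ k) = (- 1) ^ k * w" for k
  proof (induction k)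
    case (Suc k)
    have "w ^ ((CARD('p) ^ s) ^ Suc k) = (w ^ ((CARD('p) ^ s) ^ k)) ^ (CARD('p) ^ s)"
      by (simp add: mult.commute flip: power_mult)
    also have "\<dots> = ((- 1) ^ k) ^ (CARD('p) ^ s) * w ^ (CARD('p) ^ s)"
      by (simp add: Suc power_mult_distrib)
    also have "((- 1 :: 'a) ^ k) ^ (CARD('p) ^ s) = (- 1) ^ k"
      using odd_P by (cases "even k") simp_all
    finally show ?case by (simp add: w)
  qed simp
  then have "w ^ ((CARD('p) ^ s) ^ n) = - w" using odd_n by simp
  moreover have "w ^ ((CARD('p) ^ s) ^ n) = w"
    using frobenius_period[OF CARD_eq, of w s] by (simp add: mult.commute flip: power_mult)
  ultimately have "2 * w = 0" by (metis add.right_inverse mult_2)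
  then show ?thesis using two_nonzero by simp
qed

text \<open>On a finite field injectivity suffices. The map is additive, and dividing the kernel
  equation by z^(p^s+1) leaves w^(p^s) = -w for the quotient w of the kernel element by
  \<open>z\<close>.\<close>

lemma polarization_surj:
  assumes "z \<noteq> 0"
  shows "surj (\<lambda>y :: 'a. y ^ (CARD('p) ^ s) * z + z ^ (CARD('p) ^ s) * y)"
proof (rule finite_UNIV_inj_surj)
  show "inj (\<lambda>y. y ^ (CARD('p) ^ s) * z + z ^ (CARD('p) ^ s) * y)"
  proof (rule injI)
    fix x y :: 'a
    assume eq: "x ^ (CARD('p) ^ s) * z + z ^ (CARD('p) ^ s) * x
      = y ^ (CARD('p) ^ s) * z + z ^ (CARD('p) ^ s) * y"
    have "x ^ (CARD('p) ^ s) = (x - y) ^ (CARD('p) ^ s) + y ^ (CARD('p) ^ s)"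
      using frobenius_add[OF CARD_eq, of "x - y" y s] by simp
    with eq have "(x - y) ^ (CARD('p) ^ s) * z + z ^ (CARD('p) ^ s) * (x - y) = 0"
      by (simp add: algebra_simps)
    then have "((x - y) / z) ^ (CARD('p) ^ s) = - ((x - y) / z)"
      using assms by (simp add: field_simps eq_neg_iff_add_eq_0)
    then have "(x - y) / z = 0" by (rule frobenius_neg_fixed_zero)
    then show "x = y" using assms by simp
  qed
qed simp

section \<open>Exponent vectors and their character sums\<close>

lemma exponent_vec_nth: "E a b $ x = tr (a * x + 2 * b ^ (CARD('p) ^ s) * x ^ (CARD('p) ^ s + 1))"
proof -
  have "tr (b * x ^ (CARD('p) ^ (n - s) + 1)) = tr ((b * x ^ (CARD('p) ^ (n - s) + 1)) ^ (CARD('p) ^ s))"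
    by (rule tr_frobenius[symmetric])
  \<comment> \<open>The power p^s turns x^(p^(n-s)) into x^(p^n) = x and the remaining factor x into
    x^(p^s), which gives the third monomial of the definition.\<close>
  also have "(b * x ^ (CARD('p) ^ (n - s) + 1)) ^ (CARD('p) ^ s)
      = b ^ (CARD('p) ^ s) * (x ^ (CARD('p) ^ (n - s) * CARD('p) ^ s) * x ^ (CARD('p) ^ s))"
    by (simp only: power_mult_distrib power_add power_one_right power_mult)
  also have "CARD('p) ^ (n - s) * CARD('p) ^ s = CARD('p) ^ (n * 1)"
    using s_le_n by (simp flip: power_add)
  also have "x ^ (CARD('p) ^ (n * 1)) = x" by (rule frobenius_period[OF CARD_eq])
  finally have "tr (b * x ^ (CARD('p) ^ (n - s) + 1)) = tr (b ^ (CARD('p) ^ s) * x ^ (CARD('p) ^ s + 1))"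
    by simp
  moreover have "tr (2 * b ^ (CARD('p) ^ s) * x ^ (CARD('p) ^ s + 1))
      = tr (b ^ (CARD('p) ^ s) * x ^ (CARD('p) ^ s + 1)) + tr (b ^ (CARD('p) ^ s) * x ^ (CARD('p) ^ s + 1))"
    unfolding tr_add[symmetric] by (simp add: algebra_simps)
  ultimately show ?thesis by (simp add: E_def exponent_vec_def tr_add flip: tr_def)
qed

text \<open>The second parameter enters only through its p^s-th power, which is additive in
  characteristic p.\<close>

lemma exponent_vec_add: "E (a + a') (b + b') = E a b + E a' b'"
  by (simp add: vec_eq_iff exponent_vec_nth frobenius_add[OF CARD_eq] flip: tr_add)
    (simp add: algebra_simps)

lemma exponent_vec_diff: "E (a - a') (b - b') = E a b - E a' b'"
  using exponent_vec_add[of "a - a'" a' "b - b'" b'] by simp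

text \<open>Prime field scalars are fixed by the Frobenius power applied to \<open>b\<close>, and
  they can be pulled out of the trace.\<close>

lemma exponent_vec_scale: "E (of_prime_field c * a) (of_prime_field c * b) = c *s E a b"
proof -
  have "of_prime_field c * a * x + 2 * (of_prime_field c * b) ^ (CARD('p) ^ s) * x ^ (CARD('p) ^ s + 1)
      = of_prime_field c * (a * x + 2 * b ^ (CARD('p) ^ s) * x ^ (CARD('p) ^ s + 1))" for x
    by (simp add: power_mult_distrib of_prime_field_frobenius[OF CARD_eq] algebra_simps)
  then show ?thesis
    by (simp only: vec_eq_iff exponent_vec_nth tr_scale vector_smult_component)
      simp
qed

lemma linear_character_sum:
  "(\<Sum>x\<in>UNIV. omega_pow (tr (a * x))) = (if a = 0 then of_nat CARD('a) else 0)"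
proof (cases "a = 0")
  case True
  then show ?thesis by simp
next
  case False
  obtain t where "tr t \<noteq> 0" using tr_nonzero by blast
  \<comment> \<open>Some \<open>t\<close> has nonzero trace, and \<open>t / a\<close> is its
    preimage under multiplication by \<open>a\<close>.\<close>
  then have "tr (a * (t / a)) \<noteq> 0" using False by simp
  moreover have "tr (a * (x + y)) = tr (a * x) + tr (a * y)" for x y
    by (simp add: distrib_left tr_add)
  ultimately have "(\<Sum>x\<in>UNIV. omega_pow (tr (a * x))) = 0"
    by (intro character_sum_zero[where z = "t / a"])
  with False show ?thesis by simp
qed

text \<open>For a fixed nonzero shift \<open>z\<close>, the difference of the exponents at
  \<open>y + z\<close> and \<open>y\<close> is a constant plus the additive function
  \<open>tr (c * L y)\<close>. Surjectivity of \<open>L\<close> makes that function nonzero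
  somewhere, so its character sum vanishes.\<close>

lemma exponent_vec_character_sum:
  assumes "b \<noteq> 0"
  shows "(cmod (\<Sum>x\<in>UNIV. omega_pow (E a b $ x)))\<^sup>2 = real CARD('a)"
proof (rule character_sum_flat)
  fix z :: 'a assume z: "z \<noteq> 0"
  define L where "L = (\<lambda>y. y ^ (CARD('p) ^ s) * z + z ^ (CARD('p) ^ s) * y)"
  define c where "c = 2 * b ^ (CARD('p) ^ s)"
  let ?B = "\<lambda>y. tr (c * L y)"
  have nth: "E a b $ x = tr (a * x + c * (x * x ^ (CARD('p) ^ s)))" for x
    by (simp add: exponent_vec_nth c_def)
  have diff: "E a b $ (y + z) - E a b $ y = E a b $ z + ?B y" for y
  proof -
    have "a * (y + z) + c * ((y + z) * (y + z) ^ (CARD('p) ^ s))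
      = (a * z + c * (z * z ^ (CARD('p) ^ s))) + c * L y + (a * y + c * (y * y ^ (CARD('p) ^ s)))"
      unfolding frobenius_add[OF CARD_eq] L_def by (simp add: algebra_simps)
    then show ?thesis unfolding nth by (simp only: tr_add) simp
  qed
  obtain t where t: "tr t \<noteq> 0" using tr_nonzero by blast
  have "surj L" unfolding L_def by (rule polarization_surj[OF z])
  \<comment> \<open>At this \<open>y\<close> the additive part takes the value \<open>tr t\<close>,
    which is nonzero.\<close>
  then obtain y where y: "L y = t / c" by (metis surjD)
  have "c \<noteq> 0" using \<open>b \<noteq> 0\<close> two_nonzero by (simp add: c_def)
  then have "?B y \<noteq> 0" using t by (simp add: y)
  moreover have "?B (x + y) = ?B x + ?B y" for x y
  proof -
    have "L (x + y) = L x + L y"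
      unfolding L_def frobenius_add[OF CARD_eq] by (simp add: algebra_simps)
    then show ?thesis by (simp only: distrib_left tr_add)
  qed
  ultimately have "(\<Sum>y\<in>UNIV. omega_pow (?B y)) = 0"
    by (intro character_sum_zero[where z = y])
  then have "(\<Sum>y\<in>UNIV. omega_pow (E a b $ z) * omega_pow (?B y)) = 0"
    by (simp only: mult_zero_right flip: sum_distrib_left)
  then show "(\<Sum>y\<in>UNIV. omega_pow (E a b $ (y + z) - E a b $ y)) = 0"
    by (simp only: diff omega_pow_add)
qed

section \<open>The bases and their mutual unbiasedness\<close>

lemma herm_inner_exponent_vec:
  "herm_inner (phase_vec (E a b)) (phase_vec (E a' b)) = (if a = a' then 1 else 0)"
  \<comment> \<open>The difference of the exponent vectors is \<open>E (a' - a) 0\<close>, so only a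
    linear character sum remains.\<close>
  by (simp add: herm_inner_phase_vec flip: exponent_vec_diff)
    (simp add: exponent_vec_nth linear_character_sum power_0_left)

text \<open>The difference of the exponent vectors has the nonzero second parameter
  \<open>b' - b\<close>, so the squared modulus is q divided by q^2.\<close>

lemma cmod_herm_inner_exponent_vec:
  assumes "b \<noteq> b'"
  shows "(cmod (herm_inner (phase_vec (E a b)) (phase_vec (E a' b'))))\<^sup>2 = 1 / real CARD('a)"
proof -
  have "(cmod (\<Sum>x\<in>UNIV. omega_pow (E (a' - a) (b' - b) $ x)))\<^sup>2 = real CARD('a)"
    using assms by (intro exponent_vec_character_sum) simp
  then show ?thesis
    unfolding herm_inner_phase_vec exponent_vec_diff[symmetric]
    by (simp add: norm_divide power_divide power2_eq_square)
qed

lemma orthonormal_phase_basis: "orthonormal_basis (phase_basis b)"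
  unfolding phase_basis_def by (rule orthonormal_basis_range) (rule herm_inner_exponent_vec)

lemma phase_bases_unbiased: "b \<noteq> b' \<Longrightarrow> mutually_unbiased (phase_basis b) (phase_basis b')"
  by (auto simp: mutually_unbiased_def phase_basis_def cmod_herm_inner_exponent_vec)

lemma standard_phase_unbiased:
  "mutually_unbiased standard_basis (phase_basis b)"
  "mutually_unbiased (phase_basis b) standard_basis"
  by (auto simp: mutually_unbiased_def phase_basis_def standard_basis_def
      cmod_herm_inner_axis_phase_vec)

text \<open>Different second parameters belong to unbiased bases, which share no vector. Within one
  basis, different first parameters give orthogonal vectors.\<close>

lemma exponent_vec_eq_iff: "E a b = E a' b' \<longleftrightarrow> a = a' \<and> b = b'"
proof
  assume eq: "E a b = E a' b'"
  have "b = b'"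
  proof (rule ccontr)
    assume "b \<noteq> b'"
    then have "phase_basis b \<inter> phase_basis b' = {}"
      using mutually_unbiased_disjoint phase_bases_unbiased orthonormal_phase_basis CARD_ne_1
      by blast
    moreover have "phase_vec (E a b) \<in> phase_basis b \<inter> phase_basis b'"
      unfolding phase_basis_def by (metis IntI eq rangeI)
    ultimately show False by blast
  qed
  moreover from this have "a = a'"
    using eq herm_inner_exponent_vec by (metis zero_neq_one)
  ultimately show "a = a' \<and> b = b'" by simp
qed simp

lemma phase_bases_complete: "complete_MUBs (insert standard_basis (range phase_basis))"
proof -
  \<comment> \<open>Unbiased bases are disjoint, hence distinct as soon as one is nonempty. This
    shows that the q + 1 listed bases are really q + 1 different sets.\<close>
  have ne: "B \<noteq> C"
    if "mutually_unbiased B C" "orthonormal_basis B" "B \<noteq> {}" for B C :: "(complex, 'a) vec set"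
    using mutually_unbiased_disjoint[OF that(1,2) CARD_ne_1] that(3) by blast
  have "phase_basis b \<noteq> {}" for b by (simp add: phase_basis_def)
  then have "inj phase_basis" "standard_basis \<notin> range phase_basis"
    using ne[OF phase_bases_unbiased orthonormal_phase_basis]
      ne[OF standard_phase_unbiased(2) orthonormal_phase_basis]
    by (auto intro!: injI) metis
  then have "card (insert standard_basis (range phase_basis)) = CARD('a) + 1"
    by (simp add: card_image)
  moreover have "mutually_unbiased (phase_basis b) (phase_basis b')"
    if "phase_basis b \<noteq> phase_basis b'" for b b'
    using that phase_bases_unbiased by metis
  ultimately show ?thesis
    unfolding complete_MUBs_def
    by (auto simp: orthonormal_standard_basis orthonormal_phase_basis standard_phase_unbiased)
qed

text \<open>Every coordinate of a phase vector has squared modulus 1/q, whereas an axis vector has a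
  coordinate equal to 1.\<close>

lemma phase_vec_notin_standard_basis: "phase_vec (x :: ('p mod_ring, 'a) vec) \<notin> standard_basis"
proof
  assume "phase_vec x \<in> standard_basis"
  then obtain i where "phase_vec x = axis i 1" by (auto simp: standard_basis_def)
  then have "herm_inner (axis i 1) (phase_vec x) = 1" by (simp add: herm_inner_axis_left)
  then show False using cmod_herm_inner_axis_phase_vec(1)[of i x] CARD_ne_1 by simp
qed

section \<open>The linear space of exponent vectors\<close>

lemma mem_exponent_space: "x \<in> exponent_space \<longleftrightarrow> (\<exists>a b. x = E a b)"
  by (auto simp: exponent_space_def)

lemma subspace_exponent_space: "vec.subspace exponent_space"
proof (rule vec.subspaceI)
  show "0 \<in> exponent_space"
    using exponent_vec_diff[of 0 0 0 0] by (metis mem_exponent_space diff_self)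
next
  fix x y assume "x \<in> exponent_space" "y \<in> exponent_space"
  then show "x + y \<in> exponent_space"
    by (metis mem_exponent_space exponent_vec_add)
next
  fix c x assume "x \<in> exponent_space"
  then show "c *s x \<in> exponent_space"
    by (metis mem_exponent_space exponent_vec_scale)
qed

text \<open>The dimension is read off from the cardinality: distinct pairs (a, b) give distinct
  vectors, so there are q^2 = p^(2n) of them.\<close>

lemma dim_exponent_space: "vec.dim exponent_space = 2 * n"
proof -
  have "inj (\<lambda>(a, b). E a b)" by (auto simp: inj_def exponent_vec_eq_iff)
  then have "card exponent_space = CARD('a \<times> 'a)"
    unfolding exponent_space_def by (rule card_image)
  also have "\<dots> = CARD('p) ^ (2 * n)" by (simp add: CARD_eq mult_2 power_add)
  finally have "CARD('p) ^ vec.dim exponent_space = CARD('p) ^ (2 * n)"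
    using card_subspace[OF subspace_exponent_space] by simp
  then show ?thesis using nontriv[where 'a = 'p] by (simp only: power_inject_exp)
qed

end

theorem theorem13:
  fixes p n s q :: nat
    and v :: "'a::{field,finite} \<Rightarrow> 'a \<Rightarrow> (complex, 'a) vec"
    and X :: "(complex, 'a) vec set set"
    and N :: "(complex, 'a) vec set"
    and M :: "('p::prime_card mod_ring, 'a) vec set"
  assumes "p = CARD('p)" and "odd p"
    and "n \<ge> 1" and "odd n"
    and "q = p ^ n" and "CARD('a) = q"
    and "coprime s n" and "real s < real n / 2"
    and v: "v = (\<lambda>a b. phase_vec (exponent_vec n s a b :: ('p mod_ring, 'a) vec))"
    and X: "X = insert standard_basis (range (\<lambda>b. range (\<lambda>a. v a b)))"
    and N: "N = {u \<in> \<Union>X. \<exists>x :: ('p mod_ring, 'a) vec. u = phase_vec x}"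
    and M: "M = {x. phase_vec x \<in> N}"
  shows "complete_MUBs X \<and>
    N = {v a b |a b. True} \<and>
    Module.module (prime_field_ring :: ('p mod_ring) ring)
      (phase_module N :: ('p mod_ring, (complex, 'a) vec) module) \<and>
    PG_subspace (2 * n - 1) M \<and>
    vec.subspace M \<and> vec.dim M = 2 * n"
proof -
  have card: "CARD('a) = CARD('p) ^ n" using assms by simp
  note ctx = card \<open>odd p\<close>[unfolded \<open>p = CARD('p)\<close>] \<open>odd n\<close>
  have s: "s \<le> n" using \<open>real s < real n / 2\<close> by linarith
  \<comment> \<open>No vector of the standard basis is a phase vector, so only the vectors
    \<open>v a b\<close> survive the selection.\<close>
  have N': "N = {v a b |a b. True}"
    unfolding N X v using phase_vec_notin_standard_basis[OF ctx s] by auto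
  define M' where "M' = range (\<lambda>(a, b). exponent_vec n s a b :: ('p mod_ring, 'a) vec)"
  have "N = phase_vec ` M'"
    unfolding N' v M'_def by auto
  \<comment> \<open>\<open>phase_vec\<close> is injective, so the exponent vectors can be recovered
    from \<open>N\<close>.\<close>
  moreover from this have "M = M'"
    unfolding M by (auto simp: phase_vec_eq_iff)
  moreover have "vec.subspace M'" "vec.dim M' = 2 * n"
    unfolding M'_def by (rule subspace_exponent_space[OF ctx s], rule dim_exponent_space[OF ctx s])
  moreover have "complete_MUBs X"
    unfolding X v by (rule phase_bases_complete[OF ctx s])
  \<comment> \<open>The bound on \<open>n\<close> ensures that the truncated difference
    \<open>2 * n - 1\<close> plus 1 is \<open>2 * n\<close>, as \<open>PG_subspace\<close>
    requires.\<close>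
  ultimately show ?thesis
    using N' \<open>n \<ge> 1\<close> by (simp add: module_phase_module PG_subspace_def)
qed

end
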